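(* Let $\tilde{\mathfrak g}$ be the $5$-dimensional real solvable Lie algebra with basis $\{e_1,\dots,e_5\}$ whose nonzero brackets (up to antisymmetry) are $$[e_1,e_2]=-e_3,\quad [e_4,e_2]=-e_1,\quad [e_4,e_1]=e_2,\quad [e_5,e_1]=-e_1+e_3,$$ $$[e_5,e_2]=-e_2,\quad [e_5,e_3]=-2e_3,\quad [e_5,e_4]=e_1+\tfrac{7}{12}e_3,$$ and let $\tilde g$ be the symmetric bilinear form on $\tilde{\mathfrak g}$ whose only nonzero components $\tilde g_{ij}=\tilde g(e_i,e_j)$ are $$\tilde g_{11}=\tfrac{497}{576},\quad \tilde g_{22}=\tfrac{49}{192},\quad \tilde g_{33}=2,\quad \tilde g_{13}=\tilde g_{31}=-\tfrac{7}{6},\quad \tilde g_{44}=-\tfrac{245}{6144},\quad \tilde g_{55}=-\tfrac{1225}{6144}.$$ Then the invariant metric $\tilde g$ is an Einstein metric on $\tilde{\mathfrak g}$ with Einstein constant $\lambda=\frac{4096}{175}\neq 0$, i.e. $\widetilde{\mathrm{Ric}}=\frac{4096}{175}\,\mathrm{Id}$. Moreover, the metric Lie algebra $(\tilde{\mathfrak g},\tilde g)$ does not admit any standard decomposition.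
   Context: A metric Lie algebra is a pair $(\mathfrak g,g)$ of a real Lie algebra and a nondegenerate symmetric bilinear form $g$ (of any signature) on it; $g$ is identified with a left-invariant pseudo-Riemannian metric on the connected, simply connected Lie group with Lie algebra $\mathfrak g$. The Levi-Civita connection $\nabla$, the curvature $R(u,v)=[\nabla_u,\nabla_v]-\nabla_{[u,v]}$, the Ricci tensor $\mathrm{ric}(v,w)=\mathrm{tr}(u\mapsto R(u,v)w)$ and the Ricci operator $\mathrm{Ric}$, defined by $g(\mathrm{Ric}\,v,w)=\mathrm{ric}(v,w)$, are left-invariant and are viewed as tensors on $\mathfrak g$. The metric is Einstein with Einstein constant $\lambda\in\mathbb R$ if $\mathrm{ric}=\lambda g$, equivalently $\mathrm{Ric}=\lambda\,\mathrm{Id}$. Here $\widetilde{\mathrm{Ric}}$ is the Ricci operator of $\tilde g$. A standard decomposition of a metric Lie algebra $\tilde{\mathfrak g}$ is a decomposition $\tilde{\mathfrak g}=\mathfrak g\oplus^{\perp}\mathfrak a$ (orthogonal direct sum of vector spaces), where $\mathfrak g$ is a nilpotent ideal of $\tilde{\mathfrak g}$ and $\mathfrak a$ is an abelian subalgebra of $\tilde{\mathfrak g}$. *)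

theory Defs
  imports "HOL-Analysis.Analysis"
begin

definition lie_algebra :: "(real^'n \<Rightarrow> real^'n \<Rightarrow> real^'n) \<Rightarrow> bool" where
  "lie_algebra br \<longleftrightarrow> bilinear br \<and> (\<forall>x. br x x = 0) \<and>
     (\<forall>x y z. br x (br y z) + br y (br z x) + br z (br x y) = 0)"

definition bracket_span ::
    "(real^'n \<Rightarrow> real^'n \<Rightarrow> real^'n) \<Rightarrow> (real^'n) set \<Rightarrow> (real^'n) set \<Rightarrow> (real^'n) set" where
  "bracket_span br A B = span {br x y | x y. x \<in> A \<and> y \<in> B}"

primrec derived_series ::
    "(real^'n \<Rightarrow> real^'n \<Rightarrow> real^'n) \<Rightarrow> (real^'n) set \<Rightarrow> nat \<Rightarrow> (real^'n) set" where
  "derived_series br h 0 = h"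
| "derived_series br h (Suc k) = bracket_span br (derived_series br h k) (derived_series br h k)"

primrec lower_central_series ::
    "(real^'n \<Rightarrow> real^'n \<Rightarrow> real^'n) \<Rightarrow> (real^'n) set \<Rightarrow> nat \<Rightarrow> (real^'n) set" where
  "lower_central_series br h 0 = h"
| "lower_central_series br h (Suc k) = bracket_span br h (lower_central_series br h k)"

definition lie_subalgebra :: "(real^'n \<Rightarrow> real^'n \<Rightarrow> real^'n) \<Rightarrow> (real^'n) set \<Rightarrow> bool" where
  "lie_subalgebra br h \<longleftrightarrow> subspace h \<and> (\<forall>x\<in>h. \<forall>y\<in>h. br x y \<in> h)"

definition lie_ideal :: "(real^'n \<Rightarrow> real^'n \<Rightarrow> real^'n) \<Rightarrow> (real^'n) set \<Rightarrow> bool" where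
  "lie_ideal br h \<longleftrightarrow> subspace h \<and> (\<forall>x. \<forall>y\<in>h. br x y \<in> h)"

definition lie_abelian :: "(real^'n \<Rightarrow> real^'n \<Rightarrow> real^'n) \<Rightarrow> (real^'n) set \<Rightarrow> bool" where
  "lie_abelian br h \<longleftrightarrow> (\<forall>x\<in>h. \<forall>y\<in>h. br x y = 0)"

definition lie_nilpotent :: "(real^'n \<Rightarrow> real^'n \<Rightarrow> real^'n) \<Rightarrow> (real^'n) set \<Rightarrow> bool" where
  "lie_nilpotent br h \<longleftrightarrow> (\<exists>k. lower_central_series br h k = {0})"

definition lie_solvable :: "(real^'n \<Rightarrow> real^'n \<Rightarrow> real^'n) \<Rightarrow> (real^'n) set \<Rightarrow> bool" where
  "lie_solvable br h \<longleftrightarrow> (\<exists>k. derived_series br h k = {0})"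

definition metric_lie_algebra ::
    "(real^'n \<Rightarrow> real^'n \<Rightarrow> real^'n) \<Rightarrow> (real^'n \<Rightarrow> real^'n \<Rightarrow> real) \<Rightarrow> bool" where
  "metric_lie_algebra br g \<longleftrightarrow> lie_algebra br \<and>
     bilinear g \<and> (\<forall>x y. g x y = g y x) \<and> (\<forall>x. (\<forall>y. g x y = 0) \<longrightarrow> x = 0)"

text \<open>
  The Levi-Civita connection of the left-invariant metric \<open>g\<close>, restricted to left-invariant
  vector fields: functions \<open>g u v\<close> are then constant, so metric compatibility says that each
  \<open>\<nabla> u\<close> is skew with respect to \<open>g\<close>. The descriptions \<open>THE\<close> here and in
  \<open>ricci_operator\<close> denote the intended object for metric Lie algebras, where existence and
  uniqueness hold because \<open>g\<close> is nondegenerate.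
\<close>

definition is_levi_civita ::
    "(real^'n \<Rightarrow> real^'n \<Rightarrow> real^'n) \<Rightarrow> (real^'n \<Rightarrow> real^'n \<Rightarrow> real) \<Rightarrow>
     (real^'n \<Rightarrow> real^'n \<Rightarrow> real^'n) \<Rightarrow> bool" where
  "is_levi_civita br g D \<longleftrightarrow> bilinear D \<and>
     (\<forall>u v. D u v - D v u = br u v) \<and>
     (\<forall>u v w. g (D u v) w + g v (D u w) = 0)"

definition levi_civita ::
    "(real^'n \<Rightarrow> real^'n \<Rightarrow> real^'n) \<Rightarrow> (real^'n \<Rightarrow> real^'n \<Rightarrow> real) \<Rightarrow>
     real^'n \<Rightarrow> real^'n \<Rightarrow> real^'n" where
  "levi_civita br g = (THE D. is_levi_civita br g D)"

definition curvature ::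
    "(real^'n \<Rightarrow> real^'n \<Rightarrow> real^'n) \<Rightarrow> (real^'n \<Rightarrow> real^'n \<Rightarrow> real) \<Rightarrow>
     real^'n \<Rightarrow> real^'n \<Rightarrow> real^'n \<Rightarrow> real^'n" where
  "curvature br g u v w = (let D = levi_civita br g in D u (D v w) - D v (D u w) - D (br u v) w)"

definition ricci_tensor ::
    "(real^'n \<Rightarrow> real^'n \<Rightarrow> real^'n) \<Rightarrow> (real^'n \<Rightarrow> real^'n \<Rightarrow> real) \<Rightarrow>
     real^'n \<Rightarrow> real^'n \<Rightarrow> real" where
  "ricci_tensor br g v w = trace (matrix (\<lambda>u. curvature br g u v w))"

definition ricci_operator ::
    "(real^'n \<Rightarrow> real^'n \<Rightarrow> real^'n) \<Rightarrow> (real^'n \<Rightarrow> real^'n \<Rightarrow> real) \<Rightarrow>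
     real^'n \<Rightarrow> real^'n" where
  "ricci_operator br g v = (THE z. \<forall>w. g z w = ricci_tensor br g v w)"

definition einstein ::
    "(real^'n \<Rightarrow> real^'n \<Rightarrow> real^'n) \<Rightarrow> (real^'n \<Rightarrow> real^'n \<Rightarrow> real) \<Rightarrow> real \<Rightarrow> bool" where
  "einstein br g c \<longleftrightarrow> (\<forall>v w. ricci_tensor br g v w = c * g v w)"

definition standard_decomposition ::
    "(real^'n \<Rightarrow> real^'n \<Rightarrow> real^'n) \<Rightarrow> (real^'n \<Rightarrow> real^'n \<Rightarrow> real) \<Rightarrow>
     (real^'n) set \<Rightarrow> (real^'n) set \<Rightarrow> bool" where
  "standard_decomposition br g h a \<longleftrightarrow>
     lie_ideal br h \<and> lie_nilpotent br h \<and>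
     lie_subalgebra br a \<and> lie_abelian br a \<and>
     h \<inter> a = {0} \<and> {x + y | x y. x \<in> h \<and> y \<in> a} = UNIV \<and>
     (\<forall>x\<in>h. \<forall>y\<in>a. g x y = 0)"

text \<open>
  The index type \<open>5\<close> has the elements \<open>1, 2, 3, 4, 5\<close>, with \<open>5 = 0\<close>;
  the basis vector \<open>e\<^sub>i\<close> is \<open>axis i 1\<close>.
\<close>

abbreviation e :: "5 \<Rightarrow> real^5" where
  "e i \<equiv> axis i 1"

text \<open>
  The two-form \<open>e\<^sup>i \<and> e\<^sup>j\<close>: it is \<open>1\<close> on \<open>(e\<^sub>i, e\<^sub>j)\<close>, \<open>-1\<close> on
  \<open>(e\<^sub>j, e\<^sub>i)\<close> and \<open>0\<close> on the other pairs of basis vectors when \<open>i \<noteq> j\<close>, so each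
  summand of \<open>tilde_bracket\<close> prescribes one bracket of basis vectors.
\<close>

definition wedge :: "5 \<Rightarrow> 5 \<Rightarrow> real^5 \<Rightarrow> real^5 \<Rightarrow> real" where
  "wedge i j x y = x $ i * y $ j - x $ j * y $ i"

definition tilde_bracket :: "real^5 \<Rightarrow> real^5 \<Rightarrow> real^5" where
  "tilde_bracket x y =
     wedge 1 2 x y *\<^sub>R (- e 3) +
     wedge 4 2 x y *\<^sub>R (- e 1) +
     wedge 4 1 x y *\<^sub>R e 2 +
     wedge 5 1 x y *\<^sub>R (- e 1 + e 3) +
     wedge 5 2 x y *\<^sub>R (- e 2) +
     wedge 5 3 x y *\<^sub>R (- 2 *\<^sub>R e 3) +
     wedge 5 4 x y *\<^sub>R (e 1 + (7/12) *\<^sub>R e 3)"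

definition tilde_metric :: "real^5 \<Rightarrow> real^5 \<Rightarrow> real" where
  "tilde_metric x y =
     497/576 * (x $ 1 * y $ 1) + 49/192 * (x $ 2 * y $ 2) + 2 * (x $ 3 * y $ 3)
     - 7/6 * (x $ 1 * y $ 3 + x $ 3 * y $ 1)
     - 245/6144 * (x $ 4 * y $ 4) - 1225/6144 * (x $ 5 * y $ 5)"

lemma tilde_bracket_basis:
  "tilde_bracket (e 1) (e 2) = - e 3"
  "tilde_bracket (e 1) (e 3) = 0"
  "tilde_bracket (e 2) (e 3) = 0"
  "tilde_bracket (e 4) (e 1) = e 2"
  "tilde_bracket (e 4) (e 2) = - e 1"
  "tilde_bracket (e 4) (e 3) = 0"
  "tilde_bracket (e 5) (e 1) = - e 1 + e 3"
  "tilde_bracket (e 5) (e 2) = - e 2"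
  "tilde_bracket (e 5) (e 3) = - 2 *\<^sub>R e 3"
  "tilde_bracket (e 5) (e 4) = e 1 + (7/12) *\<^sub>R e 3"
  "tilde_bracket y x = - tilde_bracket x y"
  by (simp_all add: tilde_bracket_def wedge_def axis_def algebra_simps)

end

theory Submission
  imports Defs
begin

text \<open>
  \<^emph>\<open>The Einstein equation.\<close> Koszul's formula expresses \<open>2 g(D u v, w)\<close> through brackets and
  the metric alone, so a nondegenerate metric has at most one Levi-Civita connection
  (\<open>is_levi_civita_unique\<close>). It therefore suffices to write down the product that the formula
  yields here, \<open>tilde_nabla\<close>, and to check that it is torsion-free and metric. The Ricci tensor is
  then a sum of five curvature components, which is compared with the metric coefficient by
  coefficient.

  \<^emph>\<open>No standard decomposition.\<close> Let \<open>h\<close> be a nilpotent ideal with an abelian orthogonal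
  complement \<open>a\<close>. As the quotient by \<open>h\<close> is abelian, \<open>h\<close> contains the derived algebra, which is
  spanned by \<open>e\<^sub>1, e\<^sub>2, e\<^sub>3\<close>. It is no larger: modulo the derived algebra, an element of \<open>h\<close> is
  \<open>s e\<^sub>4 + t e\<^sub>5\<close>. On \<open>e\<^sub>3\<close> it acts with eigenvalue \<open>- 2 t\<close>, so nilpotency of \<open>h\<close> forces \<open>t = 0\<close>;
  then, \<open>e\<^sub>4\<close> acting on \<open>e\<^sub>1, e\<^sub>2\<close> as a rotation, it forces \<open>s = 0\<close>. So \<open>h\<close> is the derived algebra
  and \<open>a\<close>, its orthogonal complement, is the plane of \<open>e\<^sub>4\<close> and \<open>e\<^sub>5\<close>. But these two do not
  commute.
\<close>

section \<open>The Levi-Civita connection of a metric Lie algebra\<close>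

text \<open>
  Cyclically permuting metric compatibility and eliminating the reversed products by torsion-freeness
  isolates \<open>g (D u v) w\<close>; this is Koszul's formula. Nondegeneracy then determines \<open>D u v\<close>.
\<close>

lemma is_levi_civita_unique:
  assumes M: "metric_lie_algebra br g" and D: "is_levi_civita br g D" and E: "is_levi_civita br g E"
  shows "D = E"
proof -
  have g: "bilinear g" and sym: "g x y = g y x" for x y
    using M by (auto simp: metric_lie_algebra_def)
  have diff: "g (x - y) z = g x z - g y z" for x y z
    using g by (rule bilinear_lsub)
  have koszul: "2 * g (F u v) w = g (br u v) w - g (br v w) u + g (br w u) v"
    if F: "is_levi_civita br g F" for F u v w
  proof -
    have br: "br x y = F x y - F y x" and skew: "g (F x y) z = - g (F x z) y" for x y z
      using F sym unfolding is_levi_civita_def by (metis, metis add_eq_0_iff)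
    show ?thesis
      unfolding br diff
      using skew[of u v w] skew[of v u w] skew[of w v u] by simp
  qed
  have "g (D u v - E u v) w = 0" for u v w
    using koszul[OF D, of u v w] koszul[OF E, of u v w] by (simp add: diff)
  then show ?thesis
    using M unfolding metric_lie_algebra_def by (metis eq_iff_diff_eq_0 ext)
qed

lemma levi_civita_eqI:
  assumes "metric_lie_algebra br g" and "is_levi_civita br g D"
  shows "levi_civita br g = D"
  unfolding levi_civita_def using assms is_levi_civita_unique by blast

lemma ricci_operator_einstein:
  assumes M: "metric_lie_algebra br g" and E: "einstein br g c"
  shows "ricci_operator br g v = c *\<^sub>R v"
  unfolding ricci_operator_def
proof (rule the_equality)
  have g: "bilinear g" using M by (simp add: metric_lie_algebra_def)
  then show *: "\<forall>w. g (c *\<^sub>R v) w = ricci_tensor br g v w"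
    using E by (simp add: einstein_def bilinear_lmul)
  fix z assume "\<forall>w. g z w = ricci_tensor br g v w"
  then have "\<forall>w. g (z - c *\<^sub>R v) w = 0"
    using * g by (simp add: bilinear_lsub)
  then show "z = c *\<^sub>R v"
    using M unfolding metric_lie_algebra_def by (metis eq_iff_diff_eq_0)
qed

section \<open>Ideals of Lie algebras\<close>

lemma lie_algebra_antisym:
  assumes "lie_algebra br"
  shows "br y x = - br x y"
proof -
  have b: "bilinear br" and alt: "br z z = 0" for z
    using assms by (auto simp: lie_algebra_def)
  have "0 = br (x + y) (x + y)" by (rule alt[symmetric])
  also have "\<dots> = br x x + br y y + (br x y + br y x)"
    by (simp add: bilinear_ladd[OF b] bilinear_radd[OF b] ac_simps)
  also have "\<dots> = br x y + br y x" by (simp add: alt)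
  finally show ?thesis by (metis eq_neg_iff_add_eq_0 add.commute)
qed

text \<open>
  A subset that \<open>h\<close> reproduces by bracketing survives in every term of the lower central series.
\<close>

lemma not_lie_nilpotentI:
  assumes "V \<subseteq> h" and step: "V \<subseteq> bracket_span br h V" and "v \<in> V" "v \<noteq> 0"
  shows "\<not> lie_nilpotent br h"
proof -
  have "V \<subseteq> lower_central_series br h k" for k
  proof (induction k)
    case (Suc k)
    then have "bracket_span br h V \<subseteq> lower_central_series br h (Suc k)"
      unfolding bracket_span_def lower_central_series.simps by (intro span_mono) blast
    with step show ?case by blast
  qed (use \<open>V \<subseteq> h\<close> in simp)
  with \<open>v \<in> V\<close> \<open>v \<noteq> 0\<close> show ?thesis
    unfolding lie_nilpotent_def by blast
qed

text \<open>
  The quotient by \<open>h\<close> is an image of \<open>a\<close>, hence abelian, so \<open>h\<close> contains the derived algebra.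
\<close>

lemma bracket_in_complemented_ideal:
  assumes L: "lie_algebra br" and h: "lie_ideal br h" and a: "lie_abelian br a"
    and sum: "{x + y | x y. x \<in> h \<and> y \<in> a} = UNIV"
  shows "br x y \<in> h"
proof -
  have b: "bilinear br" using L by (simp add: lie_algebra_def)
  have sub: "subspace h" and ideal: "br u v \<in> h" if "v \<in> h" for u v
    using h that by (auto simp: lie_ideal_def)
  have ideal': "br v u \<in> h" if "v \<in> h" for u v
    using ideal[OF that, of u] sub[OF that] lie_algebra_antisym[OF L, of v u]
    by (simp add: subspace_neg)
  obtain p q where x: "x = p + q" "p \<in> h" "q \<in> a" using sum by blast
  obtain r s where y: "y = r + s" "r \<in> h" "s \<in> a" using sum by blast
  have "br q s = 0" using a x y by (simp add: lie_abelian_def)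
  then have "br x y = br p y + br q r"
    using b x y by (simp add: bilinear_ladd bilinear_radd)
  then show ?thesis
    using ideal' ideal sub x y by (simp add: subspace_add)
qed

section \<open>Coordinates in the five-dimensional algebra\<close>

lemma exhaust_5:
  fixes i :: 5
  shows "i = 1 \<or> i = 2 \<or> i = 3 \<or> i = 4 \<or> i = 5"
proof (induct i)
  case (of_int z)
  then have "0 \<le> z" "z < 5" by simp_all
  then have "z = 0 \<or> z = 1 \<or> z = 2 \<or> z = 3 \<or> z = 4" by arith
  then show ?case by auto
qed

lemma forall_5: "(\<forall>i::5. P i) \<longleftrightarrow> P 1 \<and> P 2 \<and> P 3 \<and> P 4 \<and> P 5"
  by (metis exhaust_5)

lemma sum_5: "sum f (UNIV :: 5 set) = f 1 + f 2 + f 3 + f 4 + f 5"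
proof -
  have U: "UNIV = {1, 2, 3, 4, 5 :: 5}" using exhaust_5 by auto
  show ?thesis unfolding U by (simp add: ac_simps)
qed

lemma e_nth:
  "e i $ j = (if j = i then 1 else 0)"
  by (simp add: axis_def)

lemma tilde_bracket_nth:
  "tilde_bracket x y $ 1 = wedge 2 4 x y - wedge 5 1 x y + wedge 5 4 x y"
  "tilde_bracket x y $ 2 = wedge 4 1 x y - wedge 5 2 x y"
  "tilde_bracket x y $ 3 = wedge 5 1 x y - wedge 1 2 x y - 2 * wedge 5 3 x y + 7/12 * wedge 5 4 x y"
  "tilde_bracket x y $ 4 = 0"
  "tilde_bracket x y $ 5 = 0"
  by (simp_all add: tilde_bracket_def wedge_def e_nth)

lemma lie_algebra_tilde_bracket: "lie_algebra tilde_bracket"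
  unfolding lie_algebra_def bilinear_def linear_iff vec_eq_iff forall_5
  by (simp add: tilde_bracket_nth wedge_def algebra_simps)

lemma metric_lie_algebra_tilde: "metric_lie_algebra tilde_bracket tilde_metric"
proof -
  have "bilinear tilde_metric"
    unfolding bilinear_def linear_iff by (simp add: tilde_metric_def algebra_simps add_divide_distrib)
  moreover have "tilde_metric x y = tilde_metric y x" for x y
    by (simp add: tilde_metric_def algebra_simps)
  moreover have "x = 0" if x: "\<forall>y. tilde_metric x y = 0" for x
    using x[rule_format, of "e 1"] x[rule_format, of "e 2"] x[rule_format, of "e 3"]
      x[rule_format, of "e 4"] x[rule_format, of "e 5"]
    by (simp add: tilde_metric_def e_nth vec_eq_iff forall_5)
  ultimately show ?thesis
    unfolding metric_lie_algebra_def using lie_algebra_tilde_bracket by blast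
qed

text \<open>
  The derived algebra is a Heisenberg algebra (the set \<open>U\<close> below), whose centre \<open>Z\<close> contains all
  its brackets.
\<close>

lemma lie_solvable_tilde_bracket: "lie_solvable tilde_bracket UNIV"
proof -
  define U :: "(real^5) set" where "U = {x. x $ 4 = 0 \<and> x $ 5 = 0}"
  define Z :: "(real^5) set" where "Z = {x. x $ 1 = 0 \<and> x $ 2 = 0 \<and> x $ 4 = 0 \<and> x $ 5 = 0}"
  have step: "derived_series tilde_bracket UNIV (Suc k) \<subseteq> C"
    if "derived_series tilde_bracket UNIV k \<subseteq> B" "subspace C"
      "\<And>x y. x \<in> B \<Longrightarrow> y \<in> B \<Longrightarrow> tilde_bracket x y \<in> C" for k B C
    unfolding derived_series.simps bracket_span_def using that by (intro span_minimal) auto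
  have "derived_series tilde_bracket UNIV (Suc 0) \<subseteq> U"
    by (rule step[of _ UNIV]) (auto simp: U_def tilde_bracket_nth subspace_def)
  then have "derived_series tilde_bracket UNIV (Suc (Suc 0)) \<subseteq> Z"
    by (rule step) (auto simp: U_def Z_def tilde_bracket_nth wedge_def subspace_def)
  then have "derived_series tilde_bracket UNIV (Suc (Suc (Suc 0))) \<subseteq> {0}"
    by (rule step) (auto simp: Z_def tilde_bracket_nth wedge_def vec_eq_iff forall_5)
  moreover have "0 \<in> derived_series tilde_bracket UNIV (Suc (Suc (Suc 0)))"
    by (simp add: bracket_span_def span_zero)
  ultimately show ?thesis
    unfolding lie_solvable_def by blast
qed

section \<open>The Einstein equation\<close>

text \<open>The solution of Koszul's formula for \<open>tilde_metric\<close>.\<close>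

definition tilde_nabla :: "real^5 \<Rightarrow> real^5 \<Rightarrow> real^5" where
  "tilde_nabla x y =
     (16/5 * (x $ 1 * y $ 2) + 7/3 * (x $ 1 * y $ 5) + 16/5 * (x $ 2 * y $ 1)
        - 192/35 * (x $ 2 * y $ 3) - 1/5 * (x $ 2 * y $ 4)
        - 192/35 * (x $ 3 * y $ 2) - 16/7 * (x $ 3 * y $ 5)
        - 6/5 * (x $ 4 * y $ 2) - 1/2 * (x $ 4 * y $ 5)
        + 4/3 * (x $ 5 * y $ 1) - 16/7 * (x $ 5 * y $ 3)
        + 1/2 * (x $ 5 * y $ 4)) *\<^sub>R e 1 +
     (- 32/7 * (x $ 1 * y $ 1) + 192/49 * (x $ 1 * y $ 3)
        + 25/21 * (x $ 1 * y $ 4) + (x $ 2 * y $ 5)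
        + 192/49 * (x $ 3 * y $ 1) - 16/7 * (x $ 3 * y $ 4)
        + 46/21 * (x $ 4 * y $ 1) - 16/7 * (x $ 4 * y $ 3)) *\<^sub>R e 2 +
     (41/30 * (x $ 1 * y $ 2) - 1/72 * (x $ 1 * y $ 5)
        + 71/30 * (x $ 2 * y $ 1) - 16/5 * (x $ 2 * y $ 3)
        - 49/120 * (x $ 2 * y $ 4) - 16/5 * (x $ 3 * y $ 2)
        + 2/3 * (x $ 3 * y $ 5) - 49/120 * (x $ 4 * y $ 2)
        - 7/24 * (x $ 4 * y $ 5) + 71/72 * (x $ 5 * y $ 1)
        - 4/3 * (x $ 5 * y $ 3) + 7/24 * (x $ 5 * y $ 4)) *\<^sub>R e 3 +
     (160/21 * (x $ 1 * y $ 2) + 16/7 * (x $ 1 * y $ 5)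
        + 160/21 * (x $ 2 * y $ 1) - 512/35 * (x $ 2 * y $ 3)
        - 512/35 * (x $ 3 * y $ 2) + 16/7 * (x $ 5 * y $ 1)) *\<^sub>R e 4 +
     (5344/525 * (x $ 1 * y $ 1) - 16896/1225 * (x $ 1 * y $ 3)
        - 16/35 * (x $ 1 * y $ 4) + 32/25 * (x $ 2 * y $ 2)
        - 16896/1225 * (x $ 3 * y $ 1) + 24576/1225 * (x $ 3 * y $ 3)
        - 16/35 * (x $ 4 * y $ 1)) *\<^sub>R e 5"

lemma tilde_nabla_nth:
  "tilde_nabla x y $ 1 =
      16/5 * (x $ 1 * y $ 2) + 7/3 * (x $ 1 * y $ 5) + 16/5 * (x $ 2 * y $ 1)
        - 192/35 * (x $ 2 * y $ 3) - 1/5 * (x $ 2 * y $ 4)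
        - 192/35 * (x $ 3 * y $ 2) - 16/7 * (x $ 3 * y $ 5)
        - 6/5 * (x $ 4 * y $ 2) - 1/2 * (x $ 4 * y $ 5)
        + 4/3 * (x $ 5 * y $ 1) - 16/7 * (x $ 5 * y $ 3)
        + 1/2 * (x $ 5 * y $ 4)"
  "tilde_nabla x y $ 2 =
      - 32/7 * (x $ 1 * y $ 1) + 192/49 * (x $ 1 * y $ 3)
        + 25/21 * (x $ 1 * y $ 4) + (x $ 2 * y $ 5)
        + 192/49 * (x $ 3 * y $ 1) - 16/7 * (x $ 3 * y $ 4)
        + 46/21 * (x $ 4 * y $ 1) - 16/7 * (x $ 4 * y $ 3)"
  "tilde_nabla x y $ 3 =
      41/30 * (x $ 1 * y $ 2) - 1/72 * (x $ 1 * y $ 5)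
        + 71/30 * (x $ 2 * y $ 1) - 16/5 * (x $ 2 * y $ 3)
        - 49/120 * (x $ 2 * y $ 4) - 16/5 * (x $ 3 * y $ 2)
        + 2/3 * (x $ 3 * y $ 5) - 49/120 * (x $ 4 * y $ 2)
        - 7/24 * (x $ 4 * y $ 5) + 71/72 * (x $ 5 * y $ 1)
        - 4/3 * (x $ 5 * y $ 3) + 7/24 * (x $ 5 * y $ 4)"
  "tilde_nabla x y $ 4 =
      160/21 * (x $ 1 * y $ 2) + 16/7 * (x $ 1 * y $ 5)
        + 160/21 * (x $ 2 * y $ 1) - 512/35 * (x $ 2 * y $ 3)
        - 512/35 * (x $ 3 * y $ 2) + 16/7 * (x $ 5 * y $ 1)"
  "tilde_nabla x y $ 5 =
      5344/525 * (x $ 1 * y $ 1) - 16896/1225 * (x $ 1 * y $ 3)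
        - 16/35 * (x $ 1 * y $ 4) + 32/25 * (x $ 2 * y $ 2)
        - 16896/1225 * (x $ 3 * y $ 1) + 24576/1225 * (x $ 3 * y $ 3)
        - 16/35 * (x $ 4 * y $ 1)"
  by (simp_all add: tilde_nabla_def e_nth)

lemma is_levi_civita_tilde_nabla: "is_levi_civita tilde_bracket tilde_metric tilde_nabla"
proof -
  have "bilinear tilde_nabla"
    unfolding bilinear_def linear_iff vec_eq_iff forall_5
    by (simp add: tilde_nabla_nth algebra_simps add_divide_distrib)
  moreover have "tilde_nabla u v - tilde_nabla v u = tilde_bracket u v" for u v
    unfolding vec_eq_iff forall_5
    by (simp add: tilde_nabla_nth tilde_bracket_nth wedge_def algebra_simps
        add_divide_distrib diff_divide_distrib)
  moreover have "tilde_metric (tilde_nabla u v) w + tilde_metric v (tilde_nabla u w) = 0" for u v w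
    by (simp add: tilde_metric_def tilde_nabla_nth algebra_simps
        add_divide_distrib diff_divide_distrib)
  ultimately show ?thesis
    by (simp add: is_levi_civita_def)
qed

lemma einstein_tilde_metric: "einstein tilde_bracket tilde_metric (4096/175)"
  unfolding einstein_def
proof (intro allI)
  fix v w
  have D: "levi_civita tilde_bracket tilde_metric = tilde_nabla"
    by (rule levi_civita_eqI[OF metric_lie_algebra_tilde is_levi_civita_tilde_nabla])
  have "ricci_tensor tilde_bracket tilde_metric v w =
      (\<Sum>i\<in>UNIV. (tilde_nabla (e i) (tilde_nabla v w) - tilde_nabla v (tilde_nabla (e i) w)
        - tilde_nabla (tilde_bracket (e i) v) w) $ i)"
    by (simp add: ricci_tensor_def trace_def matrix_def curvature_def D)
  also have "\<dots> = 4096/175 * tilde_metric v w"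
    by (simp add: sum_5 tilde_nabla_nth tilde_bracket_nth wedge_def e_nth tilde_metric_def
        algebra_simps add_divide_distrib diff_divide_distrib)
  finally show "ricci_tensor tilde_bracket tilde_metric v w = 4096/175 * tilde_metric v w" .
qed

section \<open>No standard decomposition\<close>

text \<open>
  A nonzero fifth coordinate would make \<open>e 3\<close> an eigenvector of \<open>x\<close> with nonzero eigenvalue;
  without it, a nonzero fourth coordinate would make \<open>x\<close> rotate the plane of \<open>e 1\<close> and \<open>e 2\<close>, up
  to multiples of \<open>e 3\<close>. In either case the lower central series of \<open>h\<close> would not reach \<open>0\<close>.
\<close>

lemma nilpotent_ideal_coordinates:
  assumes h: "subspace h" and nil: "lie_nilpotent tilde_bracket h"
    and e: "e 1 \<in> h" "e 2 \<in> h" "e 3 \<in> h" and x: "x \<in> h"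
  shows "x $ 4 = 0 \<and> x $ 5 = 0"
proof -
  have in_span: "v \<in> bracket_span tilde_bracket h V"
    if "y \<in> h" "u \<in> V" "tilde_bracket y u = c *\<^sub>R v" "c \<noteq> 0" for V y u v c
  proof -
    have "tilde_bracket y u \<in> bracket_span tilde_bracket h V"
      unfolding bracket_span_def using that by (intro span_base) blast
    then have "(1 / c) *\<^sub>R (c *\<^sub>R v) \<in> bracket_span tilde_bracket h V"
      unfolding bracket_span_def that(3) by (rule span_mul)
    then show ?thesis using that(4) by simp
  qed
  have x5: "x $ 5 = 0"
  proof (rule ccontr)
    assume "x $ 5 \<noteq> 0"
    moreover have "tilde_bracket x (e 3) = (- 2 * x $ 5) *\<^sub>R e 3"
      by (simp add: vec_eq_iff forall_5 tilde_bracket_nth wedge_def e_nth)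
    ultimately have "e 3 \<in> bracket_span tilde_bracket h {e 3}"
      using in_span[OF x, of "e 3" "{e 3}" "- 2 * x $ 5" "e 3"] by simp
    then show False
      using not_lie_nilpotentI[of "{e 3}" h tilde_bracket "e 3"] e nil by (simp add: axis_eq_0_iff)
  qed
  have "x $ 4 = 0"
  proof (rule ccontr)
    assume x4: "x $ 4 \<noteq> 0"
    \<comment> \<open>Subtracting elements of the derived algebra makes the rotation of \<open>e\<^sub>1, e\<^sub>2\<close> exact.\<close>
    define y where "y = x - x $ 1 *\<^sub>R e 1 - x $ 2 *\<^sub>R e 2 - x $ 3 *\<^sub>R e 3"
    have y: "y \<in> h"
      unfolding y_def using h x e by (intro subspace_diff subspace_scale)
    have "tilde_bracket y (e 1) = x $ 4 *\<^sub>R e 2" "tilde_bracket y (e 2) = (- x $ 4) *\<^sub>R e 1"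
      using x5 by (simp_all add: y_def vec_eq_iff forall_5 tilde_bracket_nth wedge_def e_nth)
    then have "{e 1, e 2} \<subseteq> bracket_span tilde_bracket h {e 1, e 2}"
      using in_span[OF y, of "e 1" "{e 1, e 2}" "x $ 4" "e 2"]
        in_span[OF y, of "e 2" "{e 1, e 2}" "- x $ 4" "e 1"] x4 by simp
    then show False
      using not_lie_nilpotentI[of "{e 1, e 2}" h tilde_bracket "e 1"] e nil
      by (simp add: axis_eq_0_iff)
  qed
  with x5 show ?thesis by simp
qed

lemma no_standard_decomposition_tilde:
  "\<not> standard_decomposition tilde_bracket tilde_metric h a"
proof
  assume std: "standard_decomposition tilde_bracket tilde_metric h a"
  then have ideal: "lie_ideal tilde_bracket h" and nil: "lie_nilpotent tilde_bracket h"
    and ab: "lie_abelian tilde_bracket a" and sum: "{x + y | x y. x \<in> h \<and> y \<in> a} = UNIV"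
    and orth: "\<And>x y. x \<in> h \<Longrightarrow> y \<in> a \<Longrightarrow> tilde_metric x y = 0"
    by (auto simp: standard_decomposition_def)
  have sub: "subspace h" using ideal by (simp add: lie_ideal_def)
  have br: "tilde_bracket x y \<in> h" for x y
    by (rule bracket_in_complemented_ideal[OF lie_algebra_tilde_bracket ideal ab sum])
  have e: "e 1 \<in> h" "e 2 \<in> h" "e 3 \<in> h"
    using br[of "e 4" "e 2"] br[of "e 4" "e 1"] br[of "e 1" "e 2"] sub
    by (metis tilde_bracket_basis subspace_neg minus_minus)+
  have h0: "x $ 4 = 0 \<and> x $ 5 = 0" if "x \<in> h" for x
    by (rule nilpotent_ideal_coordinates[OF sub nil e that])
  have a0: "y $ 1 = 0 \<and> y $ 2 = 0 \<and> y $ 3 = 0" if "y \<in> a" for y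
    using orth[OF e(1) that] orth[OF e(2) that] orth[OF e(3) that]
    by (simp add: tilde_metric_def e_nth)
  have a: "v \<in> a" if v: "v $ 1 = 0" "v $ 2 = 0" "v $ 3 = 0" for v
  proof -
    obtain p q where pq: "v = p + q" "p \<in> h" "q \<in> a" using sum by blast
    then have "v = q"
      using h0[of p] a0[of q] v by (simp add: vec_eq_iff forall_5)
    with pq show ?thesis by simp
  qed
  have "tilde_bracket (e 5) (e 4) = 0"
    using ab a[of "e 5"] a[of "e 4"] by (simp add: lie_abelian_def e_nth)
  then have "tilde_bracket (e 5) (e 4) $ 1 = 0" by simp
  then show False
    by (simp add: tilde_bracket_nth wedge_def e_nth)
qed

theorem theorem4p7:
  shows "metric_lie_algebra tilde_bracket tilde_metric
    \<and> lie_solvable tilde_bracket UNIV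
    \<and> einstein tilde_bracket tilde_metric (4096/175) \<and> (4096/175 :: real) \<noteq> 0
    \<and> (\<forall>v. ricci_operator tilde_bracket tilde_metric v = (4096/175) *\<^sub>R v)
    \<and> \<not> (\<exists>h a. standard_decomposition tilde_bracket tilde_metric h a)"
  using metric_lie_algebra_tilde lie_solvable_tilde_bracket einstein_tilde_metric
    ricci_operator_einstein[OF metric_lie_algebra_tilde einstein_tilde_metric]
    no_standard_decomposition_tilde
  by simp

end
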